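(* Let $\{T_\theta\}_{\theta\in U}$ satisfy the standing assumptions (i)–(iv) of the context, let $\{\theta_\varepsilon^{c}\}_{\varepsilon\downarrow0}$ be a center family, and let $\{\mathcal S_\varepsilon\}_{\varepsilon\downarrow0}$ be a slow region family of $\{\theta_\varepsilon^{c}\}_{\varepsilon\downarrow0}$ with vanishing modulus $\rho_\varepsilon$. Let $\{a_\varepsilon\}_{\varepsilon\downarrow0}$ be real numbers with $0\le a_\varepsilon<1$ and $a_\varepsilon\to0$ as $\varepsilon\downarrow0$. Define $$\tilde{\mathcal S}_\varepsilon:=\{z\in\mathcal H\mid\exists\,q\in\mathcal S_\varepsilon\ \text{s.t.}\ \|z-q\|_{\mathcal H}\le a_\varepsilon\cdot\mathrm{dist}_{\mathcal H}(q,V_\varepsilon^{c})\}.$$ Then $\{\tilde{\mathcal S}_\varepsilon\}_{\varepsilon\downarrow0}$ is also a slow region family of $\{\theta_\varepsilon^{c}\}_{\varepsilon\downarrow0}$, with vanishing modulus $\tilde\rho_\varepsilon\le\big(\rho_\varepsilon+2\sqrt{M_U/m_U}\cdot a_\varepsilon\big)/(1-a_\varepsilon)$.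
   Context: **Setting.** $\mathcal X,\mathcal Y,\mathcal H$ are finite-dimensional real Hilbert spaces, $\mathcal K\subseteq\mathcal X$ is a closed convex cone with dual cone $\mathcal K^*$. A parameter is $\theta=(\mathcal A,b,c)\in\mathcal D:=\mathcal L(\mathcal X,\mathcal Y)\times\mathcal Y\times\mathcal X$ (with $\mathcal L(\mathcal X,\mathcal Y)$ the linear maps), normed by $\|\theta\|_{\mathcal D}^2:=\|\mathcal A\|_{\mathrm{HS}}^2+\|b\|_{\mathcal Y}^2+\|c\|_{\mathcal X}^2$. Put $\mathrm{KKT}(\theta):=\{(x,y,s):\mathcal Ax=b,\ \mathcal A^*y+s=c,\ \langle x,s\rangle_{\mathcal X}=0,\ x\in\mathcal K,\ s\in\mathcal K^*\}$ and $\mathcal D_{\mathrm{KKT}}:=\{\theta\in\mathcal D:\mathrm{KKT}(\theta)\ne\emptyset\}$. Let $\bar\theta\in\mathrm{cl}(\mathcal D_{\mathrm{KKT}})$ and let $U\subset\mathcal D$ be compact with $\bar\theta\in U$. To each $\theta\in U$ is associated a map $T_\theta:\mathcal H\to\mathcal H$, with residual map $\delta_\theta:=T_\theta-\mathrm{Id}$ and fixed point set $\mathrm{Fix}(T_\theta)$. **Standing assumptions.** (i) For every $\theta\in U$: $\mathrm{Fix}(T_\theta)\ne\emptyset$ iff $\theta\in\mathcal D_{\mathrm{KKT}}$. (ii) For every $\theta\in U$, $T_\theta$ is $\alpha_\theta$-averaged for some $\alpha_\theta\in(0,1)$ (i.e. $T_\theta=(1-\alpha_\theta)\mathrm{Id}+\alpha_\theta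 N_\theta$ with $N_\theta$ nonexpansive) with respect to the inner product $\langle z,w\rangle_\theta:=\langle z,G_\theta w\rangle_{\mathcal H}$, $G_\theta$ self-adjoint positive definite on $\mathcal H$. (iii) There are $0<m_U\le M_U<\infty$ with $m_U\mathrm{Id}\preceq G_\theta\preceq M_U\mathrm{Id}$ for all $\theta\in U$. (iv) There is $L_U(r)=a+a'r$ with $a,a'\ge0$ such that $\|T_\theta z-T_{\theta'}z\|_{\mathcal H}\le L_U(\|z\|_{\mathcal H})\,\|\theta-\theta'\|_{\mathcal D}$ for all $\theta,\theta'\in U$, $z\in\mathcal H$. **Families.** All conditions on families indexed by $\varepsilon\downarrow0$ are required only for all sufficiently small $\varepsilon>0$. A center family is $\{\theta_\varepsilon^{c}\}_{\varepsilon\downarrow0}\subset U\cap\mathcal D_{\mathrm{KKT}}$ with $\theta_\varepsilon^{c}\to\bar\theta$. Write $T_\varepsilon^{c}:=T_{\theta_\varepsilon^{c}}$, $\delta_\varepsilon^{c}:=\delta_{\theta_\varepsilon^{c}}$, $V_\varepsilon^{c}:=\mathrm{Fix}(T_\varepsilon^{c})$. $\mathrm{dist}_{\mathcal H}$ is the distance in $\|\cdot\|_{\mathcal H}$. **Slow region (SR) family.** A set family $\{\mathcal S_\varepsilon\}_{\varepsilon\downarrow0}$ of subsets of $\mathcal H$ is an SR family of $\{\theta_\varepsilon^{c}\}$ iff (1) $\mathcal S_\varepsilon\ne\emptyset$ and $\mathcal S_\varepsilon\cap V_\varepsilon^{c}=\emptyset$; (2) its vanishing modulus $\rho_\varepsilon:=\sup_{z\in\mathcal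 S_\varepsilon}\|\delta_\varepsilon^{c}(z)\|_{\mathcal H}/\mathrm{dist}_{\mathcal H}(z,V_\varepsilon^{c})$ is finite and $\rho_\varepsilon\to0$ as $\varepsilon\downarrow0$. *)

theory Defs
  imports "HOL-Analysis.Analysis"
begin

text \<open>
  Finite-dimensional real Hilbert spaces.  The class \<^class>\<open>euclidean_space\<close> is contained in this
  one but excludes the zero space; completeness is automatic in finite dimension.
\<close>

class fin_dim_inner = real_inner +
  assumes finite_spanning: "\<exists>B. finite B \<and> (\<forall>x. \<exists>r. x = (\<Sum>e\<in>B. r e *\<^sub>R e))"

instance euclidean_space \<subseteq> fin_dim_inner
proof
  have "\<exists>r. x = (\<Sum>e\<in>Basis. r e *\<^sub>R e)" for x :: 'a
    using euclidean_representation[of x] by metis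
  then show "\<exists>B::'a set. finite B \<and> (\<forall>x. \<exists>r. x = (\<Sum>e\<in>B. r e *\<^sub>R e))"
    using finite_Basis by blast
qed

lemma finite_spanning_set: "\<exists>B::'a::fin_dim_inner set. finite B \<and> span B = UNIV"
proof -
  obtain B :: "'a set" where B: "finite B" "\<And>x. \<exists>r. x = (\<Sum>e\<in>B. r e *\<^sub>R e)"
    using finite_spanning by metis
  have "x \<in> span B" for x
  proof -
    obtain r where "x = (\<Sum>e\<in>B. r e *\<^sub>R e)" using B(2) by blast
    then show ?thesis by (auto intro: span_sum span_scale span_base)
  qed
  then show ?thesis using B(1) by auto
qed

definition orthonormal_basis :: "'a::real_inner set \<Rightarrow> bool" where
  "orthonormal_basis B \<longleftrightarrow>
     finite B \<and> pairwise orthogonal B \<and> (\<forall>e\<in>B. norm e = 1) \<and> span B = UNIV"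

lemma orthonormal_basis_exists: "\<exists>B::'a::fin_dim_inner set. orthonormal_basis B"
proof -
  obtain S :: "'a set" where S: "finite S" "span S = UNIV"
    using finite_spanning_set by blast
  obtain C where C: "finite C" "span C = span S" "pairwise orthogonal C"
    using basis_orthogonal[OF S(1)] by blast
  let ?B = "(\<lambda>x. x /\<^sub>R norm x) ` (C - {0})"
  have "pairwise orthogonal ?B"
    using C(3) unfolding pairwise_def by (auto simp: orthogonal_def)
  moreover have "span ?B = UNIV"
  proof -
    have "x \<in> span ?B" if "x \<in> C" for x
    proof (cases "x = 0")
      case True
      then show ?thesis by (simp add: span_zero)
    next
      case False
      then have "norm x *\<^sub>R (x /\<^sub>R norm x) \<in> span ?B"
        using that by (intro span_scale span_base) auto
      then show ?thesis using False by simp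
    qed
    then have "span C \<subseteq> span ?B"
      by (intro span_minimal) auto
    then show ?thesis using C(2) S(2) by auto
  qed
  ultimately have "orthonormal_basis ?B"
    using C(1) unfolding orthonormal_basis_def by auto
  then show ?thesis ..
qed

lemma orthonormal_basis_expansion:
  assumes "orthonormal_basis B"
  shows "x = (\<Sum>e\<in>B. (x \<bullet> e) *\<^sub>R e)"
proof -
  have fin: "finite B" and orth: "pairwise orthogonal B" and sp: "span B = UNIV"
    and nrm: "\<And>e. e \<in> B \<Longrightarrow> e \<bullet> e = 1"
    using assms by (auto simp: orthonormal_basis_def dot_square_norm)
  let ?r = "x - (\<Sum>e\<in>B. (x \<bullet> e) *\<^sub>R e)"
  have "orthogonal ?r b" if "b \<in> B" for b
  proof -
    have "(\<Sum>e\<in>B. (x \<bullet> e) * (e \<bullet> b)) = (\<Sum>e\<in>B. if e = b then x \<bullet> e else 0)"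
      using orth nrm that by (intro sum.cong) (auto simp: pairwise_def orthogonal_def)
    then show ?thesis
      using fin that by (simp add: orthogonal_def inner_diff_left inner_sum_left)
  qed
  then have "orthogonal ?r ?r"
    using orthogonal_to_span[of ?r B ?r] sp by blast
  then show ?thesis by (simp add: orthogonal_def)
qed

lemma linear_imp_bounded_linear:
  fixes f :: "'a::fin_dim_inner \<Rightarrow> 'b::real_normed_vector"
  assumes "linear f"
  shows "bounded_linear f"
proof -
  obtain B :: "'a set" where B: "orthonormal_basis B"
    using orthonormal_basis_exists by blast
  have "f x = (\<Sum>e\<in>B. (x \<bullet> e) *\<^sub>R f e)" for x
    using arg_cong[OF orthonormal_basis_expansion[OF B, of x], of f]
    by (simp add: linear_sum[OF assms] linear_scale[OF assms])
  then have f_eq: "f = (\<lambda>x. \<Sum>e\<in>B. (x \<bullet> e) *\<^sub>R f e)" by (rule ext)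
  show ?thesis
    by (subst f_eq)
      (intro bounded_linear_sum bounded_linear_scaleR_const bounded_linear_inner_left)
qed

text \<open>The value does not depend on the orthonormal basis selected; see \<open>hs_norm_eq\<close> below.\<close>

definition hs_norm :: "('x::fin_dim_inner \<Rightarrow>\<^sub>L 'y::fin_dim_inner) \<Rightarrow> real" where
  "hs_norm A = sqrt (\<Sum>e\<in>(SOME B. orthonormal_basis B). (norm (blinfun_apply A e))\<^sup>2)"

lemma orthonormal_basis_parseval:
  assumes "orthonormal_basis B"
  shows "(norm x)\<^sup>2 = (\<Sum>e\<in>B. (x \<bullet> e)\<^sup>2)"
proof -
  have "x \<bullet> x = x \<bullet> (\<Sum>e\<in>B. (x \<bullet> e) *\<^sub>R e)"
    using orthonormal_basis_expansion[OF assms, of x] by simp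
  then show ?thesis
    unfolding power2_norm_eq_inner by (simp add: inner_sum_right power2_eq_square)
qed

lemma adjoint_works_fin_dim:
  fixes f :: "'x::fin_dim_inner \<Rightarrow> 'y::real_inner"
  assumes "linear f"
  shows "f x \<bullet> y = x \<bullet> adjoint f y"
proof -
  obtain B :: "'x set" where B: "orthonormal_basis B"
    using orthonormal_basis_exists by blast
  have *: "f x \<bullet> y = x \<bullet> (\<Sum>e\<in>B. (f e \<bullet> y) *\<^sub>R e)" for x y
    using arg_cong[OF orthonormal_basis_expansion[OF B, of x], of "\<lambda>v. f v \<bullet> y"]
    by (simp add: linear_sum[OF assms] linear_scale[OF assms] inner_sum_left inner_sum_right
         mult.commute)
  then have "adjoint f = (\<lambda>y. \<Sum>e\<in>B. (f e \<bullet> y) *\<^sub>R e)"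
    by (intro adjoint_unique allI)
  then show ?thesis
    using *[of x y] by metis
qed

lemma hs_norm_eq:
  fixes A :: "'x::fin_dim_inner \<Rightarrow>\<^sub>L 'y::fin_dim_inner"
  assumes "orthonormal_basis B"
  shows "hs_norm A = sqrt (\<Sum>e\<in>B. (norm (blinfun_apply A e))\<^sup>2)"
proof -
  obtain C :: "'y set" where C: "orthonormal_basis C"
    using orthonormal_basis_exists by blast
  have lin: "linear (blinfun_apply A)"
    by (simp add: blinfun.bounded_linear_right bounded_linear.linear)
  have adj: "blinfun_apply A e \<bullet> c = adjoint (blinfun_apply A) c \<bullet> e" for e c
    using adjoint_works_fin_dim[OF lin, of e c] inner_commute[of e] by (rule trans)
  have key: "(\<Sum>e\<in>E. (norm (blinfun_apply A e))\<^sup>2)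
      = (\<Sum>c\<in>C. (norm (adjoint (blinfun_apply A) c))\<^sup>2)"
    if E: "orthonormal_basis E" for E
  proof -
    have "(\<Sum>e\<in>E. (norm (blinfun_apply A e))\<^sup>2)
        = (\<Sum>e\<in>E. \<Sum>c\<in>C. (adjoint (blinfun_apply A) c \<bullet> e)\<^sup>2)"
      by (simp only: orthonormal_basis_parseval[OF C] adj)
    also have "\<dots> = (\<Sum>c\<in>C. \<Sum>e\<in>E. (adjoint (blinfun_apply A) c \<bullet> e)\<^sup>2)"
      by (rule sum.swap)
    finally show ?thesis
      by (simp only: orthonormal_basis_parseval[OF E])
  qed
  have "orthonormal_basis (SOME B::'x set. orthonormal_basis B)"
    using orthonormal_basis_exists by (rule someI_ex)
  then show ?thesis
    unfolding hs_norm_def by (subst (1 2) key) (rule assms refl | assumption)+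
qed

text \<open>
  Parameters \<open>(A, b, c)\<close>.  By \<open>linear_imp_bounded_linear\<close> the type of bounded linear maps contains
  every linear map.  The norm carried by the product type is not \<open>param_norm\<close> (it is built from the
  operator norm), but the parameter space is finite-dimensional, so both induce the same topology;
  compactness, closure and convergence of parameters refer to that topology.
\<close>

type_synonym ('x, 'y) param = "('x \<Rightarrow>\<^sub>L 'y) \<times> 'y \<times> 'x"

definition param_norm :: "('x::fin_dim_inner, 'y::fin_dim_inner) param \<Rightarrow> real" where
  "param_norm \<theta> = (case \<theta> of (A, b, c) \<Rightarrow> sqrt ((hs_norm A)\<^sup>2 + (norm b)\<^sup>2 + (norm c)\<^sup>2))"

definition dual_cone :: "'x::real_inner set \<Rightarrow> 'x set" where
  "dual_cone K = {s. \<forall>x\<in>K. 0 \<le> x \<bullet> s}"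

definition KKT ::
  "'x::fin_dim_inner set \<Rightarrow> ('x, 'y::fin_dim_inner) param \<Rightarrow> ('x \<times> 'y \<times> 'x) set" where
  "KKT K \<theta> = (case \<theta> of (A, b, c) \<Rightarrow>
     {(x, y, s). blinfun_apply A x = b \<and> adjoint (blinfun_apply A) y + s = c \<and>
        x \<bullet> s = 0 \<and> x \<in> K \<and> s \<in> dual_cone K})"

definition D_KKT :: "'x::fin_dim_inner set \<Rightarrow> ('x, 'y::fin_dim_inner) param set" where
  "D_KKT K = {\<theta>. KKT K \<theta> \<noteq> {}}"

definition Fix :: "('h \<Rightarrow> 'h) \<Rightarrow> 'h set" where
  "Fix T = {z. T z = z}"

definition residual :: "('h \<Rightarrow> 'h) \<Rightarrow> 'h \<Rightarrow> 'h::real_vector" where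
  "residual T z = T z - z"

definition self_adjoint :: "('h::real_inner \<Rightarrow> 'h) \<Rightarrow> bool" where
  "self_adjoint G \<longleftrightarrow> linear G \<and> (\<forall>z w. G z \<bullet> w = z \<bullet> G w)"

definition pos_definite :: "('h::real_inner \<Rightarrow> 'h) \<Rightarrow> bool" where
  "pos_definite G \<longleftrightarrow> (\<forall>z. z \<noteq> 0 \<longrightarrow> 0 < z \<bullet> G z)"

definition loewner_le :: "('h::real_inner \<Rightarrow> 'h) \<Rightarrow> ('h \<Rightarrow> 'h) \<Rightarrow> bool" where
  "loewner_le F G \<longleftrightarrow> (\<forall>z. z \<bullet> F z \<le> z \<bullet> G z)"

text \<open>Norm of the inner product \<open>(z, w) \<mapsto> z \<bullet> G w\<close>.\<close>

definition metric_norm :: "('h::real_inner \<Rightarrow> 'h) \<Rightarrow> 'h \<Rightarrow> real" where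
  "metric_norm G z = sqrt (z \<bullet> G z)"

definition nonexpansive_wrt :: "('h::real_inner \<Rightarrow> 'h) \<Rightarrow> ('h \<Rightarrow> 'h) \<Rightarrow> bool" where
  "nonexpansive_wrt G N \<longleftrightarrow> (\<forall>z w. metric_norm G (N z - N w) \<le> metric_norm G (z - w))"

definition averaged_wrt :: "('h::real_inner \<Rightarrow> 'h) \<Rightarrow> real \<Rightarrow> ('h \<Rightarrow> 'h) \<Rightarrow> bool" where
  "averaged_wrt G \<alpha> T \<longleftrightarrow>
     (\<exists>N. nonexpansive_wrt G N \<and> (\<forall>z. T z = (1 - \<alpha>) *\<^sub>R z + \<alpha> *\<^sub>R N z))"

definition operator_family ::
  "'x::fin_dim_inner set \<Rightarrow> ('x, 'y::fin_dim_inner) param set \<Rightarrow>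
   (('x, 'y) param \<Rightarrow> 'h::fin_dim_inner \<Rightarrow> 'h) \<Rightarrow> (('x, 'y) param \<Rightarrow> 'h \<Rightarrow> 'h) \<Rightarrow>
   real \<Rightarrow> real \<Rightarrow> bool" where
  "operator_family K U T G m M \<longleftrightarrow>
     (\<forall>\<theta>\<in>U. Fix (T \<theta>) \<noteq> {} \<longleftrightarrow> \<theta> \<in> D_KKT K) \<and>
     (\<forall>\<theta>\<in>U. self_adjoint (G \<theta>) \<and> pos_definite (G \<theta>) \<and>
        (\<exists>\<alpha>. 0 < \<alpha> \<and> \<alpha> < 1 \<and> averaged_wrt (G \<theta>) \<alpha> (T \<theta>))) \<and>
     0 < m \<and> m \<le> M \<and>
     (\<forall>\<theta>\<in>U. loewner_le (\<lambda>z. m *\<^sub>R z) (G \<theta>) \<and> loewner_le (G \<theta>) (\<lambda>z. M *\<^sub>R z)) \<and>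
     (\<exists>l l'. 0 \<le> l \<and> 0 \<le> l' \<and>
        (\<forall>\<theta>\<in>U. \<forall>\<theta>'\<in>U. \<forall>z. norm (T \<theta> z - T \<theta>' z) \<le> (l + l' * norm z) * param_norm (\<theta> - \<theta>')))"

text \<open>
  Families indexed by \<open>\<epsilon> \<down> 0\<close> are functions of a real \<open>\<epsilon>\<close> considered along \<open>at_right 0\<close>.
\<close>

definition center_family ::
  "'x::fin_dim_inner set \<Rightarrow> ('x, 'y::fin_dim_inner) param set \<Rightarrow> ('x, 'y) param \<Rightarrow>
   (real \<Rightarrow> ('x, 'y) param) \<Rightarrow> bool" where
  "center_family K U \<theta>bar \<theta>c \<longleftrightarrow>
     (\<forall>\<^sub>F \<epsilon> in at_right 0. \<theta>c \<epsilon> \<in> U \<inter> D_KKT K) \<and> (\<theta>c \<longlongrightarrow> \<theta>bar) (at_right 0)"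

definition residual_ratio :: "('h::real_inner \<Rightarrow> 'h) \<Rightarrow> 'h \<Rightarrow> real" where
  "residual_ratio T z = norm (residual T z) / infdist z (Fix T)"

text \<open>
  A real supremum, meaningful only for nonempty \<open>S\<close> with bounded ratios; \<open>SR_family\<close> requires both.
\<close>

definition vanishing_modulus :: "('h::real_inner \<Rightarrow> 'h) \<Rightarrow> 'h set \<Rightarrow> real" where
  "vanishing_modulus T S = (SUP z\<in>S. residual_ratio T z)"

definition SR_family :: "(real \<Rightarrow> 'h::real_inner \<Rightarrow> 'h) \<Rightarrow> (real \<Rightarrow> 'h set) \<Rightarrow> bool" where
  "SR_family Tc S \<longleftrightarrow>
     (\<forall>\<^sub>F \<epsilon> in at_right 0. S \<epsilon> \<noteq> {} \<and> S \<epsilon> \<inter> Fix (Tc \<epsilon>) = {}) \<and>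
     (\<forall>\<^sub>F \<epsilon> in at_right 0. bdd_above (residual_ratio (Tc \<epsilon>) ` S \<epsilon>)) \<and>
     ((\<lambda>\<epsilon>. vanishing_modulus (Tc \<epsilon>) (S \<epsilon>)) \<longlongrightarrow> 0) (at_right 0)"

end

theory Submission
  imports Defs
begin

text \<open>
  Why the slow region survives a perturbation proportional to the distance from the fixed points.
  Fix a small \<open>\<epsilon>\<close>, write \<open>T\<close> for the center operator, \<open>V\<close> for its fixed point set, and let
  \<open>q\<close> lie in \<open>S \<epsilon>\<close> and \<open>z\<close> within \<open>a \<epsilon> * dist(q, V)\<close> of it.  Both parts of the ratio
  \<open>norm (residual T z) / dist(z, V)\<close> are controlled on the scale \<open>dist(q, V)\<close>.  The denominator is
  at least \<open>(1 - a \<epsilon>) * dist(q, V)\<close>, because the distance to a set is 1-Lipschitz.  The numerator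
  exceeds \<open>norm (residual T q)\<close> by at most \<open>2 * sqrt (M / m) * a \<epsilon> * dist(q, V)\<close>, because the residual
  of an averaged map is Lipschitz with that constant (\<open>lipschitz_residual_averaged\<close>).
  Dividing gives the claimed bound point by point (\<open>residual_ratio_perturbation\<close>), and the supremum
  over \<open>S'\<close> inherits it.

  The argument needs \<open>dist(q, V) > 0\<close> and not merely \<open>q \<notin> V\<close>.  This is where the closedness
  of \<open>V\<close>, a consequence of the Lipschitz bound, and its nonemptiness, a consequence of
  \<open>\<theta>c \<epsilon> \<in> D_KKT K\<close>, enter.  The constant \<open>2 * sqrt (M / m)\<close> does not depend on \<open>\<epsilon>\<close>, thanks to the
  uniform bounds on the metrics \<open>G \<theta>\<close>, so the new modulus is squeezed to 0.
\<close>

text \<open>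
  The residual is \<open>\<alpha> (N - id)\<close>, and \<open>N - id\<close> at most doubles distances in the metric of \<open>G\<close>.  This
  factor 2 comes from the parallelogram-type bound \<open>\<parallel>u - v\<parallel>\<^sup>2 \<le> 2 \<parallel>u\<parallel>\<^sup>2 + 2 \<parallel>v\<parallel>\<^sup>2\<close>, for which it is
  enough that the quadratic form of \<open>G\<close> is nonnegative.  Passing to the ambient norm and back costs
  the condition number \<open>M / m\<close> under the root.
\<close>

lemma lipschitz_residual_averaged:
  fixes T G :: "'h::real_inner \<Rightarrow> 'h"
  assumes lin: "linear G"
    and avg: "averaged_wrt G \<alpha> T" and \<alpha>: "0 \<le> \<alpha>" "\<alpha> \<le> 1"
    and m: "0 < m" and mM: "m \<le> M" and lower: "loewner_le (\<lambda>z. m *\<^sub>R z) G"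
    and upper: "loewner_le G (\<lambda>z. M *\<^sub>R z)"
  shows "(2 * sqrt (M / m))-lipschitz_on UNIV (residual T)"
proof (rule lipschitz_onI)
  have low: "m * (norm v)\<^sup>2 \<le> v \<bullet> G v" and up: "v \<bullet> G v \<le> M * (norm v)\<^sup>2" for v
    using lower upper by (simp_all add: loewner_le_def power2_norm_eq_inner)
  have nonneg: "0 \<le> v \<bullet> G v" for v
    using low[of v] m by (smt (verit) mult_nonneg_nonneg zero_le_power2)
  obtain N where N: "nonexpansive_wrt G N" and T: "\<And>z. T z = (1 - \<alpha>) *\<^sub>R z + \<alpha> *\<^sub>R N z"
    using avg unfolding averaged_wrt_def by blast
  fix z w
  define u where "u = N z - N w"
  define v where "v = z - w"
  have res: "residual T z - residual T w = \<alpha> *\<^sub>R (u - v)"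
    by (simp add: residual_def T u_def v_def algebra_simps)
  have u_le_v: "u \<bullet> G u \<le> v \<bullet> G v"
    using N unfolding nonexpansive_wrt_def metric_norm_def u_def v_def by simp
  have "(u - v) \<bullet> G (u - v) + (u + v) \<bullet> G (u + v) = 2 * (u \<bullet> G u) + 2 * (v \<bullet> G v)"
    by (simp add: linear_add[OF lin] linear_diff[OF lin] inner_diff_left inner_diff_right
        inner_add_left inner_add_right)
  then have "(u - v) \<bullet> G (u - v) \<le> 4 * (v \<bullet> G v)"
    using nonneg[of "u + v"] u_le_v by linarith
  then have "m * (norm (u - v))\<^sup>2 \<le> 4 * (M * (norm v)\<^sup>2)"
    using low[of "u - v"] up[of v] by linarith
  then have "(norm (u - v))\<^sup>2 \<le> 4 * (M / m) * (norm v)\<^sup>2"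
    using m by (simp add: field_simps)
  then have "sqrt ((norm (u - v))\<^sup>2) \<le> sqrt (4 * (M / m) * (norm v)\<^sup>2)"
    by (rule real_sqrt_le_mono)
  then have "norm (u - v) \<le> 2 * sqrt (M / m) * norm v"
    by (simp only: real_sqrt_mult real_sqrt_abs abs_norm_cancel real_sqrt_four)
  moreover have "\<alpha> * norm (u - v) \<le> norm (u - v)"
    using \<alpha> by (intro mult_left_le_one_le) auto
  ultimately show "dist (residual T z) (residual T w) \<le> 2 * sqrt (M / m) * dist z w"
    unfolding dist_norm res norm_scaleR v_def[symmetric] using \<alpha>(1) by linarith
qed (use m mM in simp)

lemma Fix_eq_residual_vimage: "Fix T = residual T -` {0}"
  by (auto simp: Fix_def residual_def)

lemma closed_Fix_of_lipschitz_residual: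
  fixes T :: "'h::real_normed_vector \<Rightarrow> 'h"
  assumes "C-lipschitz_on UNIV (residual T)"
  shows "closed (Fix T)"
  unfolding Fix_eq_residual_vimage
  using lipschitz_on_continuous_on[OF assms] by (intro closed_vimage) auto

lemma residual_ratio_nonneg: "0 \<le> residual_ratio T z"
  by (simp add: residual_ratio_def infdist_nonneg)

text \<open>
  The two estimates are both relative to \<open>d = dist(q, V)\<close>, which is positive and therefore cancels.
\<close>

lemma residual_ratio_perturbation:
  fixes T :: "'h::real_inner \<Rightarrow> 'h"
  assumes lip: "C-lipschitz_on UNIV (residual T)" and ne: "Fix T \<noteq> {}"
    and q: "q \<notin> Fix T" and b: "b < 1"
    and near: "norm (z - q) \<le> b * infdist q (Fix T)"
  shows "z \<notin> Fix T"
    and "residual_ratio T z \<le> (residual_ratio T q + C * b) / (1 - b)"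
proof -
  define d where "d = infdist q (Fix T)"
  have d: "0 < d"
    unfolding d_def
    using infdist_pos_not_in_closed[OF closed_Fix_of_lipschitz_residual[OF lip] ne q] .
  have "d \<le> infdist z (Fix T) + norm (z - q)"
    unfolding d_def by (metis dist_commute dist_norm infdist_triangle)
  then have den: "(1 - b) * d \<le> infdist z (Fix T)"
    using near by (simp add: d_def algebra_simps)
  have pos: "0 < (1 - b) * d" using b d by simp
  then show "z \<notin> Fix T" using den infdist_zero[of z "Fix T"] by auto
  have "norm (residual T z) \<le> norm (residual T q) + norm (residual T z - residual T q)"
    by (rule norm_triangle_sub)
  also have "norm (residual T z - residual T q) \<le> C * norm (z - q)"
    using lipschitz_onD[OF lip, of z q] by (simp add: dist_norm)
  also have "\<dots> \<le> C * (b * d)"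
    using near lipschitz_on_nonneg[OF lip] unfolding d_def by (rule mult_left_mono)
  finally have num: "norm (residual T z) \<le> norm (residual T q) + C * (b * d)" by simp
  have "residual_ratio T z \<le> (norm (residual T q) + C * (b * d)) / ((1 - b) * d)"
    unfolding residual_ratio_def using num den pos order_trans[OF norm_ge_zero num]
    by (intro frac_le)
  also have "\<dots> = (residual_ratio T q + C * b) / (1 - b)"
    using d b unfolding residual_ratio_def d_def[symmetric] by (simp add: field_simps)
  finally show "residual_ratio T z \<le> (residual_ratio T q + C * b) / (1 - b)" .
qed

text \<open>
  The bound is increasing in the ratio at \<open>q\<close>, which the modulus of \<open>S\<close> dominates, so it is uniform
  over \<open>S'\<close>.  As \<open>S'\<close> contains \<open>S\<close> (take \<open>z = q\<close>), the supremum over it is that of a nonempty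
  bounded set of nonnegative ratios.
\<close>

lemma vanishing_modulus_enlargement:
  fixes T :: "'h::real_inner \<Rightarrow> 'h"
  assumes lip: "C-lipschitz_on UNIV (residual T)" and ne: "Fix T \<noteq> {}"
    and S: "S \<noteq> {}" "S \<inter> Fix T = {}" and bdd: "bdd_above (residual_ratio T ` S)"
    and b: "0 \<le> b" "b < 1"
    and S': "S' = {z. \<exists>q\<in>S. norm (z - q) \<le> b * infdist q (Fix T)}"
  shows "S' \<noteq> {}" and "S' \<inter> Fix T = {}" and "bdd_above (residual_ratio T ` S')"
    and "vanishing_modulus T S' \<le> (vanishing_modulus T S + C * b) / (1 - b)"
    and "0 \<le> vanishing_modulus T S'"
proof -
  show ne': "S' \<noteq> {}"
  proof -
    obtain q where "q \<in> S" using S(1) by blast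
    then have "q \<in> S'" using b(1) unfolding S' by (auto intro!: bexI[of _ q] simp: infdist_nonneg)
    then show ?thesis by blast
  qed
  have *: "z \<notin> Fix T \<and> residual_ratio T z \<le> (vanishing_modulus T S + C * b) / (1 - b)"
    if "z \<in> S'" for z
  proof -
    from that obtain q where q: "q \<in> S" "norm (z - q) \<le> b * infdist q (Fix T)"
      unfolding S' by blast
    then have "q \<notin> Fix T" using S(2) by blast
    note pert = residual_ratio_perturbation[OF lip ne this b(2) q(2)]
    have "residual_ratio T q \<le> vanishing_modulus T S"
      unfolding vanishing_modulus_def by (rule cSUP_upper[OF q(1) bdd])
    then have "(residual_ratio T q + C * b) / (1 - b) \<le> (vanishing_modulus T S + C * b) / (1 - b)"
      using b(2) by (intro divide_right_mono) auto
    then show ?thesis using pert by auto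
  qed
  show "S' \<inter> Fix T = {}" using * by blast
  show bdd': "bdd_above (residual_ratio T ` S')" using conjunct2[OF *] by (rule bdd_aboveI2)
  show "vanishing_modulus T S' \<le> (vanishing_modulus T S + C * b) / (1 - b)"
    unfolding vanishing_modulus_def[of T S'] using ne' * by (intro cSUP_least) auto
  obtain z where "z \<in> S'" using ne' by blast
  then have "residual_ratio T z \<le> vanishing_modulus T S'"
    unfolding vanishing_modulus_def using bdd' by (rule cSUP_upper)
  then show "0 \<le> vanishing_modulus T S'"
    using residual_ratio_nonneg order_trans by blast
qed

theorem proposition2p6:
  fixes K :: "'x::fin_dim_inner set"
    and U :: "('x, 'y::fin_dim_inner) param set"
    and \<theta>bar :: "('x, 'y) param"
    and T G :: "('x, 'y) param \<Rightarrow> 'h::fin_dim_inner \<Rightarrow> 'h"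
    and m M :: real
    and \<theta>c :: "real \<Rightarrow> ('x, 'y) param"
    and S S' :: "real \<Rightarrow> 'h set"
    and a :: "real \<Rightarrow> real"
  assumes "closed K" and "convex_cone K"
    and "\<theta>bar \<in> closure (D_KKT K)"
    and "compact U" and "\<theta>bar \<in> U"
    and "operator_family K U T G m M"
    and "center_family K U \<theta>bar \<theta>c"
    and "SR_family (\<lambda>\<epsilon>. T (\<theta>c \<epsilon>)) S"
    and "\<forall>\<^sub>F \<epsilon> in at_right 0. 0 \<le> a \<epsilon> \<and> a \<epsilon> < 1"
    and "(a \<longlongrightarrow> 0) (at_right 0)"
    and "\<And>\<epsilon>. S' \<epsilon> = {z. \<exists>q\<in>S \<epsilon>. norm (z - q) \<le> a \<epsilon> * infdist q (Fix (T (\<theta>c \<epsilon>)))}"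
  shows "SR_family (\<lambda>\<epsilon>. T (\<theta>c \<epsilon>)) S' \<and>
    (\<forall>\<^sub>F \<epsilon> in at_right 0.
       vanishing_modulus (T (\<theta>c \<epsilon>)) (S' \<epsilon>)
         \<le> (vanishing_modulus (T (\<theta>c \<epsilon>)) (S \<epsilon>) + 2 * sqrt (M / m) * a \<epsilon>) / (1 - a \<epsilon>))"
proof -
  define C where "C = 2 * sqrt (M / m)"
  have S_ev: "\<forall>\<^sub>F \<epsilon> in at_right 0. S \<epsilon> \<noteq> {} \<and> S \<epsilon> \<inter> Fix (T (\<theta>c \<epsilon>)) = {}"
    and S_bdd: "\<forall>\<^sub>F \<epsilon> in at_right 0. bdd_above (residual_ratio (T (\<theta>c \<epsilon>)) ` S \<epsilon>)"
    and S_lim: "((\<lambda>\<epsilon>. vanishing_modulus (T (\<theta>c \<epsilon>)) (S \<epsilon>)) \<longlongrightarrow> 0) (at_right 0)"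
    using assms(8) unfolding SR_family_def by blast+
  have center: "\<forall>\<^sub>F \<epsilon> in at_right 0. \<theta>c \<epsilon> \<in> U \<inter> D_KKT K"
    using assms(7) unfolding center_family_def by blast
  have op: "Fix (T \<theta>) \<noteq> {} \<and> C-lipschitz_on UNIV (residual (T \<theta>))"
    if "\<theta> \<in> U \<inter> D_KKT K" for \<theta>
  proof -
    have \<theta>: "\<theta> \<in> U" "\<theta> \<in> D_KKT K" using that by auto
    note fam = assms(6)[unfolded operator_family_def]
    have "Fix (T \<theta>) \<noteq> {}"
      using conjunct1[OF fam] \<theta> by simp
    obtain \<alpha> where G: "linear (G \<theta>)" and \<alpha>: "0 < \<alpha>" "\<alpha> < 1" "averaged_wrt (G \<theta>) \<alpha> (T \<theta>)"
      using bspec[OF conjunct1[OF conjunct2[OF fam]] \<theta>(1)] by (auto simp: self_adjoint_def)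
    note rest = conjunct2[OF conjunct2[OF fam]]
    have mM: "0 < m" "m \<le> M"
      using conjunct1[OF rest] conjunct1[OF conjunct2[OF rest]] .
    have bounds: "\<forall>\<theta>\<in>U.
        loewner_le (\<lambda>z. m *\<^sub>R z) (G \<theta>) \<and> loewner_le (G \<theta>) (\<lambda>z. M *\<^sub>R z)"
      using conjunct1[OF conjunct2[OF conjunct2[OF rest]]] .
    have "C-lipschitz_on UNIV (residual (T \<theta>))"
      unfolding C_def
      using lipschitz_residual_averaged[OF G \<alpha>(3) _ _ mM] bspec[OF bounds \<theta>(1)] \<alpha>(1,2) by simp
    with \<open>Fix (T \<theta>) \<noteq> {}\<close> show ?thesis ..
  qed
  have "\<forall>\<^sub>F \<epsilon> in at_right 0.
      (S' \<epsilon> \<noteq> {} \<and> S' \<epsilon> \<inter> Fix (T (\<theta>c \<epsilon>)) = {}) \<and>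
      bdd_above (residual_ratio (T (\<theta>c \<epsilon>)) ` S' \<epsilon>) \<and>
      vanishing_modulus (T (\<theta>c \<epsilon>)) (S' \<epsilon>)
        \<le> (vanishing_modulus (T (\<theta>c \<epsilon>)) (S \<epsilon>) + C * a \<epsilon>) / (1 - a \<epsilon>) \<and>
      0 \<le> vanishing_modulus (T (\<theta>c \<epsilon>)) (S' \<epsilon>)"
    using S_ev S_bdd center assms(9)
  proof eventually_elim
    case (elim \<epsilon>)
    note op_\<epsilon> = op[OF elim(3)]
    note enl = vanishing_modulus_enlargement[OF conjunct2[OF op_\<epsilon>] conjunct1[OF op_\<epsilon>]
        conjunct1[OF elim(1)] conjunct2[OF elim(1)] elim(2)
        conjunct1[OF elim(4)] conjunct2[OF elim(4)] assms(11)]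
    show ?case by (intro conjI enl)
  qed
  then have ne: "\<forall>\<^sub>F \<epsilon> in at_right 0. S' \<epsilon> \<noteq> {} \<and> S' \<epsilon> \<inter> Fix (T (\<theta>c \<epsilon>)) = {}"
    and bdd: "\<forall>\<^sub>F \<epsilon> in at_right 0. bdd_above (residual_ratio (T (\<theta>c \<epsilon>)) ` S' \<epsilon>)"
    and le: "\<forall>\<^sub>F \<epsilon> in at_right 0. vanishing_modulus (T (\<theta>c \<epsilon>)) (S' \<epsilon>)
      \<le> (vanishing_modulus (T (\<theta>c \<epsilon>)) (S \<epsilon>) + C * a \<epsilon>) / (1 - a \<epsilon>)"
    and ge: "\<forall>\<^sub>F \<epsilon> in at_right 0. 0 \<le> vanishing_modulus (T (\<theta>c \<epsilon>)) (S' \<epsilon>)"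
    unfolding eventually_conj_iff by simp_all
  have "((\<lambda>\<epsilon>. (vanishing_modulus (T (\<theta>c \<epsilon>)) (S \<epsilon>) + C * a \<epsilon>) / (1 - a \<epsilon>))
      \<longlongrightarrow> (0 + C * 0) / (1 - 0)) (at_right 0)"
    by (intro tendsto_intros S_lim assms(10)) auto
  then have "((\<lambda>\<epsilon>. (vanishing_modulus (T (\<theta>c \<epsilon>)) (S \<epsilon>) + C * a \<epsilon>) / (1 - a \<epsilon>)) \<longlongrightarrow> 0)
      (at_right 0)"
    by simp
  then have "((\<lambda>\<epsilon>. vanishing_modulus (T (\<theta>c \<epsilon>)) (S' \<epsilon>)) \<longlongrightarrow> 0) (at_right 0)"
    by (rule tendsto_sandwich[OF ge le tendsto_const])
  with ne bdd le show ?thesis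
    unfolding SR_family_def C_def by (intro conjI)
qed

end
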